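(* Let $(\mathfrak g,B)$ be a Rota-Baxter Lie algebra of weight $\lambda$ with $\lambda\neq 0$, let $\widetilde B=-\lambda\,\mathrm{id}-B$, and let $\mathfrak g_+=\mathrm{Im}\,B$, $\mathfrak g_-=\mathrm{Im}\,\widetilde B$ (Lie subalgebras of $\mathfrak g$). Define $\rhd:\mathfrak g_+\times\mathfrak g_-\to\mathfrak g_-$ and $\blacktriangleright:\mathfrak g_-\times\mathfrak g_+\to\mathfrak g_+$ by $$B(x)\rhd\widetilde B(y)=\widetilde B([B(x),y]),\qquad \widetilde B(x)\blacktriangleright B(y)=B([\widetilde B(x),y]),\qquad \forall x,y\in\mathfrak g$$ (these are well defined). Then $(\mathfrak g_+,\mathfrak g_-,\rhd,\blacktriangleright)$ is a matched pair of Lie algebras.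
   Context: Lie algebras are over a field $\mathbb K$. A Rota-Baxter operator of weight $\lambda$ on a Lie algebra $\mathfrak g$ is a linear map $B:\mathfrak g\to\mathfrak g$ with $[B(x),B(y)]=B([B(x),y]+[x,B(y)]+\lambda[x,y])$ for all $x,y\in\mathfrak g$; then $(\mathfrak g,B)$ is called a Rota-Baxter Lie algebra of weight $\lambda$. A matched pair of Lie algebras is a quadruple $(\mathfrak g_+,\mathfrak g_-,\rhd,\blacktriangleright)$ where $\mathfrak g_+,\mathfrak g_-$ are Lie algebras, $\rhd:\mathfrak g_+\times\mathfrak g_-\to\mathfrak g_-$ is a representation of $\mathfrak g_+$ on the vector space $\mathfrak g_-$, $\blacktriangleright:\mathfrak g_-\times\mathfrak g_+\to\mathfrak g_+$ is a representation of $\mathfrak g_-$ on the vector space $\mathfrak g_+$, and for all $x,y\in\mathfrak g_+$, $u,v\in\mathfrak g_-$: $$x\rhd[u,v]=[x\rhd u,v]+[u,x\rhd v]+(v\blacktriangleright x)\rhd u-(u\blacktriangleright x)\rhd v,$$ $$u\blacktriangleright[x,y]=[u\blacktriangleright x,y]+[x,u\blacktriangleright y]+(y\rhd u)\blacktriangleright x-(x\rhd u)\blacktriangleright y.$$ *)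

theory Defs
  imports Complex_Main
begin

text \<open>
  Lie algebras are carried by a subspace of an ambient vector space, because the images of a
  Rota-Baxter operator are not types. The carrier \<open>UNIV\<close> gives a Lie algebra on a whole type.
\<close>

locale lie_algebra_on =
  vector_space scale
  for scale :: "'k::field \<Rightarrow> 'a::ab_group_add \<Rightarrow> 'a" +
  fixes g :: "'a set"
    and bracket :: "'a \<Rightarrow> 'a \<Rightarrow> 'a"
  assumes subspace_carrier: "subspace g"
    and bracket_closed: "\<lbrakk>x \<in> g; y \<in> g\<rbrakk> \<Longrightarrow> bracket x y \<in> g"
    and bracket_add_left:
      "\<lbrakk>x \<in> g; y \<in> g; z \<in> g\<rbrakk> \<Longrightarrow> bracket (x + y) z = bracket x z + bracket y z"
    and bracket_add_right:
      "\<lbrakk>x \<in> g; y \<in> g; z \<in> g\<rbrakk> \<Longrightarrow> bracket x (y + z) = bracket x y + bracket x z"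
    and bracket_scale_left:
      "\<lbrakk>x \<in> g; y \<in> g\<rbrakk> \<Longrightarrow> bracket (scale c x) y = scale c (bracket x y)"
    and bracket_scale_right:
      "\<lbrakk>x \<in> g; y \<in> g\<rbrakk> \<Longrightarrow> bracket x (scale c y) = scale c (bracket x y)"
    and bracket_alternating: "x \<in> g \<Longrightarrow> bracket x x = 0"
    and jacobi:
      "\<lbrakk>x \<in> g; y \<in> g; z \<in> g\<rbrakk> \<Longrightarrow>
        bracket x (bracket y z) + bracket y (bracket z x) + bracket z (bracket x y) = 0"

locale lie_representation_on =
  lie_algebra_on scale g bracket + V: vector_space scaleV
  for scale :: "'k::field \<Rightarrow> 'a::ab_group_add \<Rightarrow> 'a"
    and g :: "'a set"
    and bracket :: "'a \<Rightarrow> 'a \<Rightarrow> 'a"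
    and scaleV :: "'k \<Rightarrow> 'b::ab_group_add \<Rightarrow> 'b" +
  fixes V :: "'b set"
    and act :: "'a \<Rightarrow> 'b \<Rightarrow> 'b"
  assumes subspace_module: "V.subspace V"
    and act_closed: "\<lbrakk>x \<in> g; v \<in> V\<rbrakk> \<Longrightarrow> act x v \<in> V"
    and act_add_left: "\<lbrakk>x \<in> g; y \<in> g; v \<in> V\<rbrakk> \<Longrightarrow> act (x + y) v = act x v + act y v"
    and act_add_right: "\<lbrakk>x \<in> g; v \<in> V; w \<in> V\<rbrakk> \<Longrightarrow> act x (v + w) = act x v + act x w"
    and act_scale_left: "\<lbrakk>x \<in> g; v \<in> V\<rbrakk> \<Longrightarrow> act (scale c x) v = scaleV c (act x v)"
    and act_scale_right: "\<lbrakk>x \<in> g; v \<in> V\<rbrakk> \<Longrightarrow> act x (scaleV c v) = scaleV c (act x v)"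
    and act_bracket:
      "\<lbrakk>x \<in> g; y \<in> g; v \<in> V\<rbrakk> \<Longrightarrow> act (bracket x y) v = act x (act y v) - act y (act x v)"

locale lie_matched_pair =
  p: lie_algebra_on scalep gp bracketp +
  m: lie_algebra_on scalem gm bracketm +
  rhd: lie_representation_on scalep gp bracketp scalem gm rhd +
  brhd: lie_representation_on scalem gm bracketm scalep gp brhd
  for scalep :: "'k::field \<Rightarrow> 'a::ab_group_add \<Rightarrow> 'a"
    and gp :: "'a set"
    and bracketp :: "'a \<Rightarrow> 'a \<Rightarrow> 'a"
    and scalem :: "'k \<Rightarrow> 'b::ab_group_add \<Rightarrow> 'b"
    and gm :: "'b set"
    and bracketm :: "'b \<Rightarrow> 'b \<Rightarrow> 'b"
    and rhd :: "'a \<Rightarrow> 'b \<Rightarrow> 'b"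
    and brhd :: "'b \<Rightarrow> 'a \<Rightarrow> 'a" +
  assumes rhd_bracket:
      "\<lbrakk>x \<in> gp; u \<in> gm; v \<in> gm\<rbrakk> \<Longrightarrow>
        rhd x (bracketm u v) =
          bracketm (rhd x u) v + bracketm u (rhd x v) + rhd (brhd v x) u - rhd (brhd u x) v"
    and brhd_bracket:
      "\<lbrakk>u \<in> gm; x \<in> gp; y \<in> gp\<rbrakk> \<Longrightarrow>
        brhd u (bracketp x y) =
          bracketp (brhd u x) y + bracketp x (brhd u y) + brhd (rhd y u) x - brhd (rhd x u) y"

locale rota_baxter_lie_algebra =
  lie_algebra_on scale UNIV bracket
  for scale :: "'k::field \<Rightarrow> 'a::ab_group_add \<Rightarrow> 'a"
    and bracket :: "'a \<Rightarrow> 'a \<Rightarrow> 'a" +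
  fixes lam :: 'k
    and B :: "'a \<Rightarrow> 'a"
  assumes linear_B: "Vector_Spaces.linear scale scale B"
    and rota_baxter:
      "bracket (B x) (B y) = B (bracket (B x) y + bracket x (B y) + scale lam (bracket x y))"

definition rb_tilde ::
    "('k::field \<Rightarrow> 'a::ab_group_add \<Rightarrow> 'a) \<Rightarrow> 'k \<Rightarrow> ('a \<Rightarrow> 'a) \<Rightarrow> 'a \<Rightarrow> 'a" where
  "rb_tilde scale lam B = (\<lambda>x. - scale lam x - B x)"

text \<open>
  The map \<open>P x, Q y \<mapsto> Q [P x, y]\<close> on \<open>range P \<times> range Q\<close>. The description determines a value
  only if the right-hand side does not depend on the chosen preimages \<open>x\<close> and \<open>y\<close>; outside
  \<open>range P \<times> range Q\<close> the value is unspecified.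
\<close>

definition induced_action ::
    "('a \<Rightarrow> 'a \<Rightarrow> 'a) \<Rightarrow> ('a \<Rightarrow> 'a) \<Rightarrow> ('a \<Rightarrow> 'a) \<Rightarrow> 'a \<Rightarrow> 'a \<Rightarrow> 'a" where
  "induced_action bracket P Q a u =
    (THE w. \<exists>x y. a = P x \<and> u = Q y \<and> w = Q (bracket (P x) y))"

end

theory Submission
  imports Defs
begin

text \<open>
  Write \<open>B'\<close> for \<open>-\<lambda> id - B\<close>. The kernel of \<open>B'\<close> is stable under bracketing with
  \<open>range B\<close>, so the adjoint action of the Lie subalgebra \<open>range B\<close> descends to the quotient
  of the Lie algebra by \<open>ker B'\<close>. This quotient is \<open>range B'\<close>, and the descended action is
  exactly the map \<open>B' y \<mapsto> B' [B x, y]\<close> (\<open>induced_action_tilde\<close>). Hence the induced action is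
  well defined, and it is a representation because it is a quotient of a restricted adjoint
  representation (\<open>lie_representation_induced_action\<close>).

  The compatibility between the two actions rests on the identity
  \<open>[B x, B' y] = B' [B x, y] - B [B' y, x]\<close> (\<open>bracket_B_tilde\<close>): in the given Lie algebra, the
  bracket of \<open>a \<in> range B\<close> with \<open>u \<in> range B'\<close> is the difference of the two actions, as it is in
  the double of a matched pair. The sum of the two subalgebras need not be direct, so the
  matched pair axioms cannot be read off by comparing components in this bracket; instead both
  sides of an axiom are written as \<open>B'\<close> of an element, and these elements agree by the
  Jacobi identity and the identity above.

  Everything is symmetric in \<open>B\<close> and \<open>B'\<close>: \<open>B'\<close> is again a Rota-Baxter operator of weight
  \<open>\<lambda>\<close>, and forming \<open>-\<lambda> id - B'\<close> gives back \<open>B\<close>. So one half of each claim suffices.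
\<close>

section \<open>The complementary Rota-Baxter operator\<close>

context rota_baxter_lie_algebra
begin

abbreviation Bt :: "'a \<Rightarrow> 'a" where
  "Bt \<equiv> rb_tilde scale lam B"

lemma Bt_def: "Bt x = - scale lam x - B x"
  by (simp add: rb_tilde_def)

sublocale B: Vector_Spaces.linear scale scale B
  by (rule linear_B)

lemma linear_Bt: "Vector_Spaces.linear scale scale Bt"
  by unfold_locales
    (simp_all add: Bt_def B.add B.scale scale_right_distrib scale_right_diff_distrib
      scale_left_commute)

sublocale Bt: Vector_Spaces.linear scale scale Bt
  by (rule linear_Bt)

lemmas bracket_add = bracket_add_left[OF UNIV_I UNIV_I UNIV_I]
  bracket_add_right[OF UNIV_I UNIV_I UNIV_I]

lemmas bracket_scale = bracket_scale_left[OF UNIV_I UNIV_I]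
  bracket_scale_right[OF UNIV_I UNIV_I]

lemma bracket_minus: "bracket (- x) y = - bracket x y" "bracket x (- y) = - bracket x y"
  using bracket_scale(1)[of "-1" x y] bracket_scale(2)[of x "-1" y] by simp_all

lemma bracket_diff:
  "bracket (x - y) z = bracket x z - bracket y z"
  "bracket z (x - y) = bracket z x - bracket z y"
  using bracket_add(1)[of x "- y" z] bracket_add(2)[of z x "- y"]
  by (simp_all add: bracket_minus)

lemma bracket_zero: "bracket x 0 = 0"
  using bracket_diff(2)[of x 0 0] by simp

lemmas bracket_bilinear = bracket_add bracket_diff bracket_minus bracket_scale

lemma bracket_skew: "bracket x y = - bracket y x"
proof -
  have "bracket (x + y) (x + y) = 0" "bracket x x = 0" "bracket y y = 0"
    by (simp_all only: bracket_alternating UNIV_I)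
  then show ?thesis
    by (simp add: bracket_add add_eq_0_iff)
qed

lemma bracket_derivation:
  "bracket x (bracket y z) = bracket (bracket x y) z + bracket y (bracket x z)"
proof -
  have "bracket x (bracket y z) + bracket y (bracket z x) + bracket z (bracket x y) = 0"
    by (simp only: jacobi UNIV_I)
  moreover have "bracket y (bracket z x) = - bracket y (bracket x z)"
    by (subst bracket_skew[of z x]) (rule bracket_minus)
  moreover have "bracket z (bracket x y) = - bracket (bracket x y) z"
    by (rule bracket_skew)
  ultimately show ?thesis
    by (simp add: algebra_simps)
qed

lemma scale_lam: "scale lam x = - B x - Bt x"
  by (simp add: Bt_def)

text \<open>The weight term of the Rota-Baxter identity combines with one of the other two.\<close>

lemma rota_baxter_split: "bracket (B x) (B y) = B (bracket (B x) y - bracket x (Bt y))"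
  by (simp add: rota_baxter Bt_def bracket_bilinear algebra_simps)

lemma bracket_B_tilde: "bracket (B x) (Bt y) = Bt (bracket (B x) y) - B (bracket (Bt y) x)"
proof -
  have "bracket (B x) (Bt y) = - scale lam (bracket (B x) y) - bracket (B x) (B y)"
    by (simp add: Bt_def bracket_bilinear)
  also have "\<dots> = Bt (bracket (B x) y) + B (bracket x (Bt y))"
    by (simp add: rota_baxter_split scale_lam B.diff)
  also have "bracket x (Bt y) = - bracket (Bt y) x"
    by (rule bracket_skew)
  finally show ?thesis
    by (simp add: B.neg)
qed

text \<open>
  Writing \<open>Bt x = - lam x - B x\<close> turns \<open>[Bt x, Bt y]\<close> into a mixed bracket \<open>[B x, Bt y]\<close> and a
  multiple of \<open>[x, Bt y]\<close>. In the expansion by \<open>bracket_B_tilde\<close> the values of \<open>B\<close> cancel and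
  values of \<open>Bt\<close> remain.
\<close>

lemma rota_baxter_tilde: "rota_baxter_lie_algebra scale bracket lam Bt"
proof unfold_locales
  fix x y
  have "bracket (Bt x) (Bt y) = - scale lam (bracket x (Bt y)) - bracket (B x) (Bt y)"
    by (simp add: Bt_def[of x] bracket_bilinear)
  also have "\<dots> = Bt (bracket x (Bt y)) - Bt (bracket (B x) y)
      + B (bracket x (Bt y)) + B (bracket (Bt y) x)"
    by (simp add: bracket_B_tilde scale_lam)
  also have "bracket (Bt y) x = - bracket x (Bt y)"
    by (rule bracket_skew)
  also have "Bt (bracket x (Bt y)) - Bt (bracket (B x) y)
      + B (bracket x (Bt y)) + B (- bracket x (Bt y))
      = Bt (bracket x (Bt y) - bracket (B x) y)"
    by (simp add: B.neg Bt.diff)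
  also have "bracket x (Bt y) - bracket (B x) y
      = bracket (Bt x) y + bracket x (Bt y) + scale lam (bracket x y)"
    by (simp add: Bt_def[of x] bracket_bilinear)
  finally show "bracket (Bt x) (Bt y)
      = Bt (bracket (Bt x) y + bracket x (Bt y) + scale lam (bracket x y))" .
qed

lemma rb_tilde_involution: "rb_tilde scale lam Bt = B"
  by (rule ext) (simp add: rb_tilde_def)

lemma lie_algebra_on_range: "lie_algebra_on scale (range B) bracket"
proof unfold_locales
  show "subspace (range B)"
    by (rule B.subspace_image) (rule subspace_UNIV)
  show "bracket x y \<in> range B" if "x \<in> range B" "y \<in> range B" for x y
    using that by (auto simp: rota_baxter)
qed (simp_all only: bracket_bilinear bracket_alternating jacobi UNIV_I)

section \<open>The induced action as a quotient of the adjoint action\<close>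

text \<open>
  On \<open>ker Bt\<close> the operator \<open>B\<close> is multiplication by \<open>-lam\<close>, so for \<open>z \<in> ker Bt\<close> the
  Rota-Baxter identity for \<open>x\<close> and \<open>z\<close> says that \<open>B\<close> multiplies \<open>[B x, z]\<close> by \<open>-lam\<close> too.
\<close>

lemma kernel_tilde_stable:
  assumes "Bt z = 0"
  shows "Bt (bracket (B x) z) = 0"
proof -
  have "bracket (B x) (B z) = B (bracket (B x) z)"
    using assms by (simp add: rota_baxter_split bracket_zero)
  moreover have "B z = - scale lam z"
    using assms by (simp add: Bt_def algebra_simps)
  ultimately show ?thesis
    by (simp add: Bt_def bracket_bilinear)
qed

lemma induced_action_tilde:
  "induced_action bracket B Bt (B x) (Bt y) = Bt (bracket (B x) y)"
  unfolding induced_action_def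
proof (rule the_equality)
  fix w
  assume "\<exists>x' y'. B x = B x' \<and> Bt y = Bt y' \<and> w = Bt (bracket (B x') y')"
  then obtain y' where "Bt y = Bt y'" and w: "w = Bt (bracket (B x) y')"
    by auto
  then have "Bt (y' - y) = 0"
    by (simp add: Bt.diff)
  then have "Bt (bracket (B x) (y' - y)) = 0"
    by (rule kernel_tilde_stable)
  then show "w = Bt (bracket (B x) y)"
    by (simp add: w bracket_diff Bt.diff)
qed blast

text \<open>
  The acting element \<open>B x\<close> enters only through its own value, not through the choice of
  \<open>x\<close>; in this form the representation axioms reduce to those of the adjoint action.
\<close>

lemma induced_action_range:
  "a \<in> range B \<Longrightarrow> induced_action bracket B Bt a (Bt y) = Bt (bracket a y)"
  by (auto simp: induced_action_tilde)

lemma lie_representation_induced_action: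
  "lie_representation_on scale (range B) bracket scale (range Bt) (induced_action bracket B Bt)"
proof -
  interpret R: lie_algebra_on scale "range B" bracket
    by (rule lie_algebra_on_range)
  show ?thesis
  proof
    let ?act = "induced_action bracket B Bt"
    show "subspace (range Bt)"
      by (rule Bt.subspace_image) (rule subspace_UNIV)
    fix a u assume a: "a \<in> range B" and "u \<in> range Bt"
    then obtain y where u: "u = Bt y" by blast
    show "?act a u \<in> range Bt"
      by (simp add: induced_action_range a u)
    show "?act (scale c a) u = scale c (?act a u)" for c
      by (simp add: induced_action_range a u subspace_scale[OF R.subspace_carrier]
          bracket_scale Bt.scale)
    show "?act a (scale c u) = scale c (?act a u)" for c
      by (simp add: induced_action_range a u bracket_scale flip: Bt.scale)
    show "?act a (u + v) = ?act a u + ?act a v" if "v \<in> range Bt" for v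
    proof -
      from that obtain z where v: "v = Bt z" by blast
      show ?thesis
        by (simp add: induced_action_range a u v bracket_add flip: Bt.add)
    qed
    show "?act (a + b) u = ?act a u + ?act b u" if "b \<in> range B" for b
      by (simp add: induced_action_range a that u subspace_add[OF R.subspace_carrier]
          bracket_add Bt.add)
    show "?act (bracket a b) u = ?act a (?act b u) - ?act b (?act a u)"
      if "b \<in> range B" for b
      by (simp add: induced_action_range a that u R.bracket_closed bracket_derivation[of a b y]
          flip: Bt.diff)
  qed
qed

section \<open>Compatibility of the two actions\<close>

text \<open>
  This is the matched pair axiom for \<open>a\<close>, \<open>u\<close> and \<open>v\<close>, with the actions and \<open>[u, v]\<close>
  expanded. Both sides are \<open>Bt\<close> of an element. After the derivation rule for \<open>[a, _]\<close>,
  these two elements differ by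
  \<open>[[a, u] + B [a, y] + B [u, x], z] + [y, [a, v] + B [a, z] + B [v, x]] + lam [a, [y, z]]\<close>.
  By \<open>bracket_B_tilde\<close>, the two inner sums are \<open>- lam [a, y]\<close> and \<open>- lam [a, z]\<close>, and the
  derivation rule makes the total vanish.
\<close>

lemma matched_pair_identity:
  fixes x y z
  defines "a \<equiv> B x" and "u \<equiv> Bt y" and "v \<equiv> Bt z"
  shows "Bt (bracket a (bracket u z + bracket y v + scale lam (bracket y z)))
    = bracket (Bt (bracket a y)) v + bracket u (Bt (bracket a z))
      + Bt (bracket (B (bracket v x)) y) - Bt (bracket (B (bracket u x)) z)"
proof -
  interpret T: rota_baxter_lie_algebra scale bracket lam Bt
    by (rule rota_baxter_tilde)
  have mixed: "bracket a (Bt w)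
      = - scale lam (bracket a w) - B (bracket a w) - B (bracket (Bt w) x)" for w
    by (simp add: a_def bracket_B_tilde scale_lam)
  have "bracket (bracket a u) z = - scale lam (bracket (bracket a y) z)
      - bracket (B (bracket a y)) z - bracket (B (bracket u x)) z"
    unfolding u_def mixed[of y] by (simp add: bracket_bilinear)
  moreover have "bracket y (bracket a v) = - scale lam (bracket y (bracket a z))
      - bracket y (B (bracket a z)) + bracket (B (bracket v x)) y"
    unfolding v_def mixed[of z]
    using bracket_skew[of "B (bracket (Bt z) x)" y] by (simp add: bracket_bilinear)
  moreover have "bracket a (bracket u z + bracket y v + scale lam (bracket y z))
      = bracket (bracket a u) z + bracket u (bracket a z)
        + (bracket (bracket a y) v + bracket y (bracket a v))
        + (scale lam (bracket (bracket a y) z) + scale lam (bracket y (bracket a z)))"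
    by (simp add: bracket_add bracket_scale bracket_derivation[of a u z]
        bracket_derivation[of a y v] bracket_derivation[of a y z] scale_right_distrib)
  ultimately have args: "bracket a (bracket u z + bracket y v + scale lam (bracket y z))
      = (bracket (bracket a y) v - bracket (B (bracket a y)) z)
        + (bracket u (bracket a z) - bracket y (B (bracket a z)))
        + bracket (B (bracket v x)) y - bracket (B (bracket u x)) z"
    by (simp only:) (simp add: algebra_simps)
  have weight: "bracket (Bt w) z + bracket w v + scale lam (bracket w z)
      = bracket w v - bracket (B w) z" for w
    by (simp add: Bt_def[of w] bracket_bilinear)
  have "bracket (Bt (bracket a y)) v
      = Bt (bracket (bracket a y) v - bracket (B (bracket a y)) z)"
    using T.rota_baxter[of "bracket a y" z] by (simp add: weight flip: v_def)
  moreover have "bracket u (Bt (bracket a z))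
      = Bt (bracket u (bracket a z) - bracket y (B (bracket a z)))"
    using T.rota_baxter_split[of y "bracket a z"]
    by (simp add: u_def rb_tilde_involution)
  ultimately show ?thesis
    by (simp add: args Bt.add Bt.diff)
qed

lemma induced_actions_compatible:
  assumes "a \<in> range B" "u \<in> range Bt" "v \<in> range Bt"
  shows "induced_action bracket B Bt a (bracket u v)
    = bracket (induced_action bracket B Bt a u) v + bracket u (induced_action bracket B Bt a v)
      + induced_action bracket B Bt (induced_action bracket Bt B v a) u
      - induced_action bracket B Bt (induced_action bracket Bt B u a) v"
proof -
  interpret T: rota_baxter_lie_algebra scale bracket lam Bt
    rewrites "rb_tilde scale lam Bt = B"
    by (rule rota_baxter_tilde) (rule rb_tilde_involution)
  from assms obtain x y z where auv: "a = B x" "u = Bt y" "v = Bt z"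
    by blast
  have "bracket u v = Bt (bracket u z + bracket y v + scale lam (bracket y z))"
    by (simp add: auv T.rota_baxter)
  then show ?thesis
    by (simp add: auv induced_action_tilde T.induced_action_tilde matched_pair_identity)
qed

end

theorem theorem2p6:
  fixes scale :: "'k::field \<Rightarrow> 'a::ab_group_add \<Rightarrow> 'a"
    and bracket :: "'a \<Rightarrow> 'a \<Rightarrow> 'a"
    and lam :: 'k
    and B :: "'a \<Rightarrow> 'a"
  defines "Bt \<equiv> rb_tilde scale lam B"
  defines "rhd \<equiv> induced_action bracket B Bt"
    and "brhd \<equiv> induced_action bracket Bt B"
  assumes "rota_baxter_lie_algebra scale bracket lam B"
    and "lam \<noteq> 0"
  shows "(\<forall>x y. rhd (B x) (Bt y) = Bt (bracket (B x) y)) \<and>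
         (\<forall>x y. brhd (Bt x) (B y) = B (bracket (Bt x) y)) \<and>
         lie_matched_pair scale (range B) bracket scale (range Bt) bracket rhd brhd"
proof -
  interpret P: rota_baxter_lie_algebra scale bracket lam B
    rewrites "rb_tilde scale lam B = Bt"
    by (rule assms) (simp only: Bt_def)
  interpret Q: rota_baxter_lie_algebra scale bracket lam Bt
    rewrites "rb_tilde scale lam Bt = B"
    by (rule P.rota_baxter_tilde) (rule P.rb_tilde_involution)
  have "lie_matched_pair scale (range B) bracket scale (range Bt) bracket rhd brhd"
    unfolding rhd_def brhd_def
    by (intro lie_matched_pair.intro lie_matched_pair_axioms.intro
        P.lie_algebra_on_range Q.lie_algebra_on_range
        P.lie_representation_induced_action Q.lie_representation_induced_action
        P.induced_actions_compatible Q.induced_actions_compatible)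
  then show ?thesis
    by (simp add: rhd_def brhd_def P.induced_action_tilde Q.induced_action_tilde)
qed

end
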